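(* Let $(P,\prec)$ be a finite poset on the vertex set $X=\{x_1,\ldots,x_n\}$ and let $G$ be its comparability graph. If $\mathcal{C}=\mathrm{cl}(G)$ is the clutter of maximal cliques of $G$, then $\mathcal{C}$ satisfies the max-flow min-cut property.
   Context: The comparability graph $G$ of $(P,\prec)$ has vertex set $X$ and edge set the set of all unordered pairs $\{x_i,x_j\}$ of distinct comparable elements. A clique of $G$ is a set of vertices inducing a complete subgraph. The clique clutter $\mathrm{cl}(G)$ has vertex set $X$ and its edges are exactly the maximal cliques of $G$ with respect to inclusion. A clutter $\mathcal{C}$ with incidence matrix $A$ (the vertex-edge matrix whose columns are the characteristic vectors of the edges) satisfies the max-flow min-cut property if both sides of the LP-duality equation $$\min\{\langle w,x\rangle\mid x\geq 0;\ xA\geq\mathbf{1}\}=\max\{\langle y,\mathbf{1}\rangle\mid y\geq 0;\ Ay\leq w\}$$ have integral optimum solutions $x$ and $y$ for each non-negative integral vector $w$, where $\mathbf{1}$ is the all-ones vector. *)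

theory Defs
  imports Complex_Main "HOL-Library.Indicator_Function"
begin

text \<open>Graphs and clutters are both represented as a pair of a vertex set and a set of edges, an
  edge being a set of vertices.\<close>

type_synonym 'a hypergraph = "'a set \<times> 'a set set"

abbreviation vertices :: "'a hypergraph \<Rightarrow> 'a set" where
  "vertices H \<equiv> fst H"

abbreviation edges :: "'a hypergraph \<Rightarrow> 'a set set" where
  "edges H \<equiv> snd H"

definition comparability_graph :: "'a set \<Rightarrow> 'a rel \<Rightarrow> 'a hypergraph" where
  "comparability_graph X r =
     (X, {{x, y} | x y. x \<in> X \<and> y \<in> X \<and> x \<noteq> y \<and> ((x, y) \<in> r \<or> (y, x) \<in> r)})"

definition clique :: "'a hypergraph \<Rightarrow> 'a set \<Rightarrow> bool" where
  "clique G K \<longleftrightarrow> K \<subseteq> vertices G \<and> (\<forall>x\<in>K. \<forall>y\<in>K. x \<noteq> y \<longrightarrow> {x, y} \<in> edges G)"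

definition maximal_clique :: "'a hypergraph \<Rightarrow> 'a set \<Rightarrow> bool" where
  "maximal_clique G K \<longleftrightarrow> clique G K \<and> (\<forall>L. clique G L \<and> K \<subseteq> L \<longrightarrow> L = K)"

definition clutter :: "'a hypergraph \<Rightarrow> bool" where
  "clutter C \<longleftrightarrow> finite (vertices C) \<and> edges C \<subseteq> Pow (vertices C) \<and>
     (\<forall>e\<in>edges C. \<forall>f\<in>edges C. e \<subseteq> f \<longrightarrow> e = f)"

definition clique_clutter :: "'a hypergraph \<Rightarrow> 'a hypergraph" where
  "clique_clutter G = (vertices G, {K. maximal_clique G K})"

lemma clutter_clique_clutter:
  assumes "finite (vertices G)"
  shows "clutter (clique_clutter G)"
  using assms
  by (auto simp: clutter_def clique_clutter_def maximal_clique_def clique_def)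

text \<open>Rows are indexed by vertices and columns by edges. Vectors indexed by a finite set are total
  functions of which only the values on that set matter.\<close>

definition incidence_matrix :: "'a \<Rightarrow> 'a set \<Rightarrow> real" where
  "incidence_matrix v e = indicator e v"

text \<open>The constraints \<open>x \<ge> 0\<close>, \<open>xA \<ge> 1\<close> of the minimisation problem.\<close>

definition primal_feasible :: "'a hypergraph \<Rightarrow> ('a \<Rightarrow> real) \<Rightarrow> bool" where
  "primal_feasible C x \<longleftrightarrow>
     (\<forall>v\<in>vertices C. 0 \<le> x v) \<and>
     (\<forall>e\<in>edges C. 1 \<le> (\<Sum>v\<in>vertices C. x v * incidence_matrix v e))"

text \<open>The constraints \<open>y \<ge> 0\<close>, \<open>Ay \<le> w\<close> of the maximisation problem.\<close>

definition dual_feasible :: "'a hypergraph \<Rightarrow> ('a \<Rightarrow> real) \<Rightarrow> ('a set \<Rightarrow> real) \<Rightarrow> bool" where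
  "dual_feasible C w y \<longleftrightarrow>
     (\<forall>e\<in>edges C. 0 \<le> y e) \<and>
     (\<forall>v\<in>vertices C. (\<Sum>e\<in>edges C. incidence_matrix v e * y e) \<le> w v)"

text \<open>Optimality is among all real feasible vectors; integrality is only required of the chosen
  optima. The last conjunct is the LP-duality equation.\<close>

definition max_flow_min_cut :: "'a hypergraph \<Rightarrow> bool" where
  "max_flow_min_cut C \<longleftrightarrow>
     (\<forall>w. (\<forall>v\<in>vertices C. 0 \<le> w v \<and> w v \<in> \<int>) \<longrightarrow>
       (\<exists>x y. (\<forall>v\<in>vertices C. x v \<in> \<int>) \<and> (\<forall>e\<in>edges C. y e \<in> \<int>) \<and>
         is_arg_min (\<lambda>x. \<Sum>v\<in>vertices C. w v * x v) (primal_feasible C) x \<and>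
         is_arg_max (\<lambda>y. \<Sum>e\<in>edges C. y e) (dual_feasible C w) y \<and>
         (\<Sum>v\<in>vertices C. w v * x v) = (\<Sum>e\<in>edges C. y e)))"

end

theory Submission
  imports Defs
begin

text \<open>By weak duality it suffices to find a vertex set meeting every maximal clique and an integral
  packing of maximal cliques whose size is at least the weight of that set.  Maximal
  cliques are the vertex sets of the paths from minimal to maximal elements in the digraph of the
  covering relation.  Replacing each vertex \<open>v\<close> by \<open>w v\<close> copies turns the claim into Menger's theorem
  for that digraph, whose proof here is Goering's induction on the set of arcs.\<close>

section \<open>Menger's theorem\<close>

text \<open>Vertices may repeat, so walks can be spliced freely; only \<open>linkage\<close> asks
  for distinct vertices. A common vertex of \<open>A\<close> and \<open>B\<close> is a walk by
  itself.\<close>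

definition walk :: "('v \<times> 'v) set \<Rightarrow> 'v set \<Rightarrow> 'v set \<Rightarrow> 'v list \<Rightarrow> bool" where
  "walk E A B p \<longleftrightarrow> p \<noteq> [] \<and> hd p \<in> A \<and> last p \<in> B \<and> successively (\<lambda>u v. (u, v) \<in> E) p"

definition separates :: "('v \<times> 'v) set \<Rightarrow> 'v set \<Rightarrow> 'v set \<Rightarrow> 'v set \<Rightarrow> bool" where
  "separates E A B Z \<longleftrightarrow> (\<forall>p. walk E A B p \<longrightarrow> set p \<inter> Z \<noteq> {})"

definition linkage :: "('v \<times> 'v) set \<Rightarrow> 'v set \<Rightarrow> 'v set \<Rightarrow> 'v list set \<Rightarrow> bool" where
  "linkage E A B L \<longleftrightarrow> finite L \<and> (\<forall>p\<in>L. walk E A B p \<and> distinct p) \<and>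
     (\<forall>p\<in>L. \<forall>q\<in>L. p \<noteq> q \<longrightarrow> set p \<inter> set q = {})"

section \<open>Walks and separators under reversal, splicing and insertion of an arc\<close>

lemma walk_rev: "walk E A B p \<longleftrightarrow> walk (E\<inverse>) B A (rev p)"
  by (auto simp: walk_def hd_rev last_rev)

lemma separates_converse: "separates E A B Z \<longleftrightarrow> separates (E\<inverse>) B A Z"
  unfolding separates_def by (metis walk_rev converse_converse rev_rev_ident set_rev)

lemma walk_mono: "walk E A B p \<Longrightarrow> E \<subseteq> E' \<Longrightarrow> walk E' A B p"
  unfolding walk_def by (auto elim: successively_mono)

lemma walk_splice:
  assumes "walk E A C (p @ v # p')" "walk E D B (q @ v # q')"
  shows "walk E A B (p @ v # q')"
  using assms unfolding walk_def
  by (auto simp: successively_append_iff hd_append split: if_splits)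

text \<open>A walk using the arc \<open>(x, y)\<close> has \<open>x\<close> before its last position
  and \<open>y\<close> after its first.\<close>

lemma walk_remove_arc:
  assumes "walk (insert (x, y) E) A B p" "x \<notin> set (butlast p) \<or> y \<notin> set (tl p)"
  shows "walk E A B p"
proof -
  have "successively (\<lambda>u v. (u, v) \<in> insert (x, y) E) p \<Longrightarrow>
      x \<notin> set (butlast p) \<or> y \<notin> set (tl p) \<Longrightarrow> successively (\<lambda>u v. (u, v) \<in> E) p" for p
    by (induction p rule: induct_list012) (auto split: if_splits)
  then show ?thesis using assms unfolding walk_def by auto
qed

text \<open>A walk that avoids the endpoint \<open>z\<close> cannot use the new arc, so it is
  already a walk in \<open>E\<close>.\<close>

lemma separates_insert_arc:
  assumes "separates E A B S" "z = x \<or> z = y"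
  shows "separates (insert (x, y) E) A B (insert z S)"
  unfolding separates_def
proof (intro allI impI)
  fix p assume p: "walk (insert (x, y) E) A B p"
  show "set p \<inter> insert z S \<noteq> {}"
  proof (cases "z \<in> set p")
    case False
    then have "walk E A B p"
      using p assms(2) walk_remove_arc in_set_butlastD list.set_sel(2) unfolding walk_def by metis
    then show ?thesis using assms(1) unfolding separates_def by blast
  qed auto
qed

text \<open>Cutting an \<open>A\<close>--\<open>B\<close> walk at its first vertex in \<open>insert x S\<close> removes all uses of the arc
  \<open>(x, y)\<close>.\<close>

lemma separates_through_tail:
  assumes S: "separates E A B S" and Z: "separates E A (insert x S) Z"
  shows "separates (insert (x, y) E) A B Z"
  unfolding separates_def
proof (intro allI impI)
  fix p assume p: "walk (insert (x, y) E) A B p"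
  then have "\<exists>v\<in>set p. v \<in> insert x S"
    using separates_insert_arc[OF S, of x x y] unfolding separates_def by blast
  then obtain q v t where q: "p = q @ v # t" "v \<in> insert x S" "\<forall>u\<in>set q. u \<notin> insert x S"
    using split_list_first_prop[of p "\<lambda>v. v \<in> insert x S"] by blast
  \<comment> \<open>Splicing with the trivial walk \<open>[v]\<close> truncates \<open>p\<close> at
    \<open>v\<close>.\<close>
  have "walk (insert (x, y) E) A (insert x S) (q @ [v])"
    by (rule walk_splice[of _ _ B _ _ t "{v}" _ "[]"]) (use p q in \<open>auto simp: walk_def\<close>)
  then have "walk E A (insert x S) (q @ [v])"
    by (rule walk_remove_arc) (use q(3) in auto)
  then show "set p \<inter> Z \<noteq> {}" using Z q(1) unfolding separates_def by fastforce
qed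

text \<open>Mirror image of \<open>separates_through_tail\<close>, obtained by reversing all
  arcs.\<close>

lemma separates_through_head:
  assumes S: "separates E A B S" and Z: "separates E (insert y S) B Z"
  shows "separates (insert (x, y) E) A B Z"
proof -
  have "separates (insert (y, x) (E\<inverse>)) B A Z"
    using S Z separates_converse by (blast intro: separates_through_tail)
  moreover have "(insert (x, y) E)\<inverse> = insert (y, x) (E\<inverse>)" by auto
  ultimately show ?thesis using separates_converse by metis
qed

section \<open>Linkages indexed by their end vertices\<close>

lemma linkage_mono: "linkage E A B L \<Longrightarrow> E \<subseteq> E' \<Longrightarrow> linkage E' A B L"
  unfolding linkage_def using walk_mono by metis

text \<open>Disjoint paths end in distinct vertices, so \<open>last\<close> is injective from
  \<open>L\<close> into \<open>C\<close>; equal cardinalities make it a bijection, and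
  \<open>P\<close> is its inverse.\<close>

lemma linkage_indexed_by_last:
  assumes L: "linkage E A C L" and C: "finite C" "card L = card C"
  obtains P where "\<And>s. s \<in> C \<Longrightarrow> walk E A C (P s) \<and> distinct (P s) \<and> last (P s) = s"
    and "\<And>s t. s \<in> C \<Longrightarrow> t \<in> C \<Longrightarrow> s \<noteq> t \<Longrightarrow> set (P s) \<inter> set (P t) = {}"
proof -
  have inj: "inj_on last L"
  proof (rule inj_onI)
    fix p q assume "p \<in> L" "q \<in> L" "last p = last q"
    then show "p = q"
      using L unfolding linkage_def walk_def by (metis disjoint_iff last_in_set)
  qed
  have "last ` L \<subseteq> C" using L unfolding linkage_def walk_def by auto
  then have im: "last ` L = C" using C inj by (metis card_image card_subset_eq)
  define P where "P s = the_inv_into L last s" for s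
  have P: "P s \<in> L" "last (P s) = s" if "s \<in> C" for s
    using that im inj f_the_inv_into_f[of last L s] the_inv_into_into[of last L s L]
    unfolding P_def by auto
  show thesis
  proof (rule that[of P])
    show "walk E A C (P s) \<and> distinct (P s) \<and> last (P s) = s" if "s \<in> C" for s
      using P[OF that] L unfolding linkage_def by auto
    show "set (P s) \<inter> set (P t) = {}" if "s \<in> C" "t \<in> C" "s \<noteq> t" for s t
      using P that L unfolding linkage_def by metis
  qed
qed

lemma linkage_rev:
  assumes "linkage E A B L"
  shows "linkage (E\<inverse>) B A (rev ` L)"
  using assms unfolding linkage_def by (auto simp: walk_rev[of E])

lemma linkage_indexed_by_hd:
  assumes L: "linkage E C B L" and C: "finite C" "card L = card C"
  obtains Q where "\<And>s. s \<in> C \<Longrightarrow> walk E C B (Q s) \<and> distinct (Q s) \<and> hd (Q s) = s"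
    and "\<And>s t. s \<in> C \<Longrightarrow> t \<in> C \<Longrightarrow> s \<noteq> t \<Longrightarrow> set (Q s) \<inter> set (Q t) = {}"
proof -
  have "card (rev ` L) = card C" using C(2) by (simp add: card_image inj_on_def)
  from linkage_indexed_by_last[OF linkage_rev[OF L] C(1) this] obtain P where
    P: "\<And>s. s \<in> C \<Longrightarrow> walk (E\<inverse>) B C (P s) \<and> distinct (P s) \<and> last (P s) = s"
      "\<And>s t. s \<in> C \<Longrightarrow> t \<in> C \<Longrightarrow> s \<noteq> t \<Longrightarrow> set (P s) \<inter> set (P t) = {}"
    by blast
  show thesis
    by (rule that[of "rev \<circ> P"]) (use P in \<open>auto simp: walk_rev[of E] hd_rev\<close>)
qed

text \<open>If removing the arc \<open>(x, y)\<close> admits a separator \<open>S\<close> with fewer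
  than \<open>k\<close> vertices, the induction hypothesis links \<open>A\<close> to
  \<open>insert x S\<close> and \<open>insert y S\<close> to \<open>B\<close> by \<open>k\<close>
  disjoint paths each. These are glued at the vertices of \<open>S\<close> and along the
  arc.\<close>

theorem menger:
  fixes E :: "('v \<times> 'v) set"
  assumes "finite E" "finite A"
    and "\<And>Z. finite Z \<Longrightarrow> separates E A B Z \<Longrightarrow> k \<le> card Z"
  shows "\<exists>L. linkage E A B L \<and> card L = k"
  using assms
proof (induction E arbitrary: A B rule: finite_induct)
  case empty
  \<comment> \<open>Without arcs every walk is a single vertex.\<close>
  have "separates {} A B (A \<inter> B)"
    unfolding separates_def walk_def
  proof (intro allI impI, elim conjE)
    fix p :: "'v list"
    assume "p \<noteq> []" "hd p \<in> A" "last p \<in> B" "successively (\<lambda>u v. (u, v) \<in> {}) p"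
    then show "set p \<inter> (A \<inter> B) \<noteq> {}" by (cases p rule: remdups_adj.cases) auto
  qed
  then obtain T where T: "T \<subseteq> A \<inter> B" "card T = k" "finite T"
    using empty by (metis finite_Int obtain_subset_with_card_n)
  have "linkage {} A B ((\<lambda>v. [v]) ` T)"
    using T unfolding linkage_def walk_def by auto
  moreover have "card ((\<lambda>v. [v]) ` T) = k"
    using T(2) by (simp add: card_image inj_on_def)
  ultimately show ?case by blast
next
  case (insert e F)
  obtain x y where e: "e = (x, y)" by force
  show ?case
  proof (cases "\<forall>Z. finite Z \<longrightarrow> separates F A B Z \<longrightarrow> k \<le> card Z")
    case True
    then show ?thesis using insert.IH[of A B] insert.prems linkage_mono by (metis subset_insertI)
  next
    case False
    then obtain S where S: "finite S" "separates F A B S" "card S < k" by force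
    have k: "k \<le> card (insert z S)" if "z = x \<or> z = y" for z
      using insert.prems(2) S(1) separates_insert_arc[OF S(2) that] e by auto
    \<comment> \<open>One extra vertex lifts the size of \<open>S\<close> from below
      \<open>k\<close> to at least \<open>k\<close>, so it is new and the result has exactly
      \<open>k\<close> vertices.\<close>
    have xy: "x \<notin> S" "y \<notin> S" and card: "card (insert x S) = k" "card (insert y S) = k"
      using k[of x] k[of y] S(1,3) by (auto simp: card_insert_if split: if_splits)
    \<comment> \<open>A set separating \<open>A\<close> from \<open>insert x S\<close> in
      \<open>F\<close> separates \<open>A\<close> from \<open>B\<close> in the whole digraph, hence
      has at least \<open>k\<close> vertices.\<close>
    obtain L where "linkage F A (insert x S) L" "card L = k"
      using insert.IH[of A "insert x S"] insert.prems separates_through_tail[OF S(2)] S(1) e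
      by (metis finite_insert)
    then obtain P where
      P: "\<And>s. s \<in> insert x S \<Longrightarrow> walk F A (insert x S) (P s) \<and> distinct (P s) \<and> last (P s) = s"
      and P_disj: "\<And>s t. s \<in> insert x S \<Longrightarrow> t \<in> insert x S \<Longrightarrow> s \<noteq> t \<Longrightarrow> set (P s) \<inter> set (P t) = {}"
      using linkage_indexed_by_last card S(1) by (metis finite_insert)
    obtain M where "linkage F (insert y S) B M" "card M = k"
      using insert.IH[of "insert y S" B] insert.prems separates_through_head[OF S(2)] S(1) e
      by (metis finite_insert)
    then obtain Q where
      Q: "\<And>s. s \<in> insert y S \<Longrightarrow> walk F (insert y S) B (Q s) \<and> distinct (Q s) \<and> hd (Q s) = s"
      and Q_disj: "\<And>s t. s \<in> insert y S \<Longrightarrow> t \<in> insert y S \<Longrightarrow> s \<noteq> t \<Longrightarrow> set (Q s) \<inter> set (Q t) = {}"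
      using linkage_indexed_by_hd card S(1) by (metis finite_insert)
    have mem: "s \<in> set (P s)" if "s \<in> insert x S" for s
      using P[OF that] unfolding walk_def by (metis last_in_set)
    have mem': "s \<in> set (Q s)" if "s \<in> insert y S" for s
      using Q[OF that] unfolding walk_def by (metis hd_in_set)
    text \<open>Following \<open>P s\<close> up to a common vertex and \<open>Q t\<close> from there on gives an \<open>A\<close>--\<open>B\<close> walk avoiding
      the arc \<open>(x, y)\<close>, so it meets \<open>S\<close>.\<close>
    have cross: "v \<in> S \<and> s = v \<and> t = v"
      if s: "s \<in> insert x S" and t: "t \<in> insert y S" and v: "v \<in> set (P s)" "v \<in> set (Q t)" for s t v
    proof -
      obtain p1 p2 where p: "P s = p1 @ v # p2" using v by (meson split_list)
      obtain q1 q2 where q: "Q t = q1 @ v # q2" using v by (meson split_list)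
      have "walk F A B (p1 @ v # q2)"
        using P[OF s] Q[OF t] p q walk_splice by metis
      then obtain u where u: "u \<in> S" "u \<in> set (p1 @ v # q2)"
        using S(2) unfolding separates_def by blast
      show ?thesis
      \<comment> \<open>If \<open>u\<close> is on the \<open>P s\<close> part, disjointness from
        \<open>P u\<close> gives \<open>u = s\<close>. As \<open>s\<close> is the last vertex of the
        distinct list \<open>P s\<close> and occurs no later than \<open>v\<close>, also
        \<open>v = s\<close>. The other case is symmetric, with first vertices.\<close>
      proof (cases "u \<in> set (p1 @ [v])")
        case True
        then have "u \<in> set (P s)" using p by auto
        then have "u = s" using P_disj[OF _ s, of u] mem[of u] u(1) by blast
        then have "v = s" using True P[OF s] p by (cases p2 rule: rev_cases) auto
        then show ?thesis
          using \<open>u = s\<close> u(1) mem'[of u] v(2) Q_disj[OF _ t, of u] by blast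
      next
        case False
        then have "u \<in> set q2" "u \<in> set (Q t)" using u q by auto
        then have "u = t" using Q_disj[OF _ t, of u] mem'[of u] u(1) by blast
        then have "v = t" using \<open>u \<in> set q2\<close> Q[OF t] q by (cases q1) auto
        then show ?thesis
          using \<open>u = t\<close> u(1) mem[of u] v(1) P_disj[OF _ s, of u] by blast
      qed
    qed
    \<comment> \<open>The continuation of \<open>P s\<close>: from \<open>x\<close> the arc leads to
      the start of \<open>Q y\<close>; for other \<open>s\<close> the list \<open>Q s\<close> begins
      with \<open>s\<close>, which must not be repeated.\<close>
    define R where "R s = (if s = x then Q y else tl (Q s))" for s
    define g where "g s = P s @ R s" for s
    have R_sub: "set (R s) \<subseteq> set (Q (if s = x then y else s))" if "s \<in> insert x S" for s
      using that unfolding R_def by (auto dest: list.set_sel(2)[rotated] split: if_splits)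
        (metis list.sel(2) list.set_sel(2))
    have R_P: "set (R s) \<inter> set (P t) = {}" if "s \<in> insert x S" "t \<in> insert x S" for s t
    proof (rule equals0I)
      fix v assume v: "v \<in> set (R s) \<inter> set (P t)"
      \<comment> \<open>The case \<open>s = x\<close> would put \<open>y\<close> into
        \<open>S\<close>. Otherwise \<open>v\<close> is the head of the distinct list
        \<open>Q s\<close>, which \<open>tl\<close> has removed.\<close>
      have c: "v \<in> S \<and> t = v \<and> (if s = x then y else s) = v"
        by (rule cross) (use that v R_sub[OF that(1)] in \<open>auto split: if_splits\<close>)
      then have "s \<noteq> x" "s = v" using xy by (auto split: if_splits)
      moreover have "s \<notin> set (tl (Q s))"
        using Q[of s] c \<open>s = v\<close> unfolding walk_def by (cases "Q s") auto
      ultimately show False using v unfolding R_def by auto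
    qed
    have R_disj: "set (R s) \<inter> set (R t) = {}" if "s \<in> insert x S" "t \<in> insert x S" "s \<noteq> t" for s t
    proof -
      have "set (Q (if s = x then y else s)) \<inter> set (Q (if t = x then y else t)) = {}"
        by (rule Q_disj) (use that xy in auto)
      then show ?thesis using R_sub[OF that(1)] R_sub[OF that(2)] by blast
    qed
    have g_disj: "set (g s) \<inter> set (g t) = {}" if "s \<in> insert x S" "t \<in> insert x S" "s \<noteq> t" for s t
      using P_disj[OF that] R_disj[OF that] R_P[OF that(1,2)] R_P[OF that(2,1)]
      unfolding g_def by auto
    have g_distinct: "distinct (g s)" if "s \<in> insert x S" for s
      using P[OF that] R_P[OF that that] Q[of s] Q[of y] that
      unfolding g_def R_def by (auto simp: distinct_tl split: if_splits)
    have g_walk: "walk (insert e F) A B (g s)" if s: "s \<in> insert x S" for s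
    proof (cases "s = x")
      case True
      have "walk (insert e F) A (insert x S) (P x)" "walk (insert e F) (insert y S) B (Q y)"
        using P[of x] Q[of y] walk_mono by (metis insertI1 subset_insertI)+
      then show ?thesis
        using True P[of x] Q[of y] e unfolding g_def R_def walk_def
        by (auto simp: successively_append_iff)
    next
      case False
      then have "s \<in> S" using s by auto
      then have "walk (insert e F) A (insert x S) (P s)" "walk (insert e F) (insert y S) B (Q s)"
        "last (P s) = hd (Q s)"
        using P[of s] Q[of s] walk_mono by (metis insertI2 subset_insertI)+
      then show ?thesis
        using False unfolding g_def R_def walk_def
        by (cases "Q s") (auto simp: successively_append_iff successively_Cons split: if_splits)
    qed
    have "linkage (insert e F) A B (g ` insert x S)"
      using g_disj g_distinct g_walk S(1) unfolding linkage_def by (auto simp del: insert_iff) blast+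
    moreover have "inj_on g (insert x S)"
    proof (rule inj_onI, rule ccontr)
      fix s t assume st: "s \<in> insert x S" "t \<in> insert x S" "g s = g t" "s \<noteq> t"
      then have "set (g s) = {}" using g_disj by (metis inf.idem)
      then show False using g_walk[OF st(1)] unfolding walk_def by simp
    qed
    ultimately show ?thesis using card card_image by metis
  qed
qed

text \<open>\<open>A\<close> is itself a finite separator, so one of least size exists, and
  \<open>menger\<close> applies with that size as \<open>k\<close>.\<close>

corollary menger_min_max:
  assumes "finite E" "finite A"
  obtains L Z where "linkage E A B L" "finite Z" "separates E A B Z" "card L = card Z"
proof -
  have "separates E A B A" unfolding separates_def walk_def by (metis disjoint_iff hd_in_set)
  then obtain Z where "finite Z \<and> separates E A B Z"
    and "\<And>Z'. finite Z' \<and> separates E A B Z' \<Longrightarrow> card Z \<le> card Z'"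
    using assms(2) ex_has_least_nat[of "\<lambda>Z. finite Z \<and> separates E A B Z" A card] by blast
  then show thesis using that menger[OF assms, where k = "card Z"] by blast
qed

section \<open>The version of Menger's theorem with vertex weights\<close>

lemma walk_subset:
  assumes "walk D A B p" "A \<subseteq> V" "D \<subseteq> V \<times> V"
  shows "set p \<subseteq> V"
proof -
  have "hd p \<in> V \<Longrightarrow> successively (\<lambda>u v. (u, v) \<in> D) p \<Longrightarrow> set p \<subseteq> V" for p
    using assms(3) by (induction p rule: induct_list012) auto
  then show ?thesis using assms unfolding walk_def by auto
qed

text \<open>The second components of the vertices in \<open>L\<close> number the copies of a vertex \<open>v\<close>, of which there
  are \<open>n v\<close>; they keep apart walks of \<open>D\<close> that are used several times.\<close>

lemma menger_weighted:
  fixes n :: "'v \<Rightarrow> nat"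
  assumes V: "finite V" "D \<subseteq> V \<times> V" "A \<subseteq> V"
  obtains L :: "('v \<times> nat) list set" and T
  where "finite L" "\<And>p. p \<in> L \<Longrightarrow> walk D A B (map fst p)"
    "\<And>v. card {p \<in> L. v \<in> fst ` set p} \<le> n v"
    "T \<subseteq> V" "separates D A B T" "sum n T \<le> card L"
proof -
  define copies where "copies U = Sigma U (\<lambda>v. {..<n v})" for U
  \<comment> \<open>Every copy of \<open>u\<close> is joined to every copy of \<open>v\<close>, so a
    walk of \<open>D\<close> lifts through any choice of copies.\<close>
  define E where "E = {((u, i), (v, j)) | u i v j. (u, v) \<in> D \<and> i < n u \<and> j < n v}"
  have fin: "finite (copies U)" if "U \<subseteq> V" for U
    using V(1) that unfolding copies_def by (auto intro: finite_subset)
  have E_sub: "E \<subseteq> copies V \<times> copies V" using V(2) unfolding E_def copies_def by auto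
  then have "finite E" using fin by (auto intro: finite_subset)
  then obtain L Z where L: "linkage E (copies A) (copies B) L" and Z: "finite Z"
    "separates E (copies A) (copies B) Z" "card L = card Z"
    using menger_min_max fin V(3) by metis
  \<comment> \<open>Vertices with all their copies in \<open>Z\<close>. Vertices of weight 0 qualify
    vacuously and add nothing to the weight of \<open>T\<close>.\<close>
  define T where "T = {v \<in> V. copies {v} \<subseteq> Z}"
  show thesis
  proof (rule that[of L T])
    show "finite L" "T \<subseteq> V" using L unfolding linkage_def T_def by auto
    show "walk D A B (map fst p)" if "p \<in> L" for p
    proof -
      have p: "walk E (copies A) (copies B) p" using L that unfolding linkage_def by auto
      then have "successively (\<lambda>x y. (fst x, fst y) \<in> D) p"
        unfolding walk_def by (auto simp: E_def elim: successively_mono)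
      then show ?thesis
        using p unfolding walk_def by (auto simp: hd_map last_map successively_map copies_def)
    qed
    show "card {p \<in> L. v \<in> fst ` set p} \<le> n v" for v
    proof -
      have "\<exists>i. (v, i) \<in> set p" if "p \<in> {p \<in> L. v \<in> fst ` set p}" for p
        using that by force
      then obtain f where f: "\<And>p. p \<in> {p \<in> L. v \<in> fst ` set p} \<Longrightarrow> (v, f p) \<in> set p"
        by metis
      \<comment> \<open>Disjoint paths through \<open>v\<close> use different copies of
        \<open>v\<close>.\<close>
      have "inj_on f {p \<in> L. v \<in> fst ` set p}"
      proof (rule inj_onI)
        fix p q assume pq: "p \<in> {p \<in> L. v \<in> fst ` set p}" "q \<in> {p \<in> L. v \<in> fst ` set p}" "f p = f q"
        then have "set p \<inter> set q \<noteq> {}" using f[of p] f[of q] by auto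
        then show "p = q" using pq(1,2) L unfolding linkage_def by blast
      qed
      moreover have "f ` {p \<in> L. v \<in> fst ` set p} \<subseteq> {..<n v}"
      proof (rule image_subsetI)
        fix p assume p: "p \<in> {p \<in> L. v \<in> fst ` set p}"
        then have "walk E (copies A) (copies B) p" using L unfolding linkage_def by auto
        moreover have "copies A \<subseteq> copies V" using V(3) unfolding copies_def by auto
        ultimately have "set p \<subseteq> copies V" using walk_subset E_sub by metis
        then show "f p \<in> {..<n v}" using f[OF p] unfolding copies_def by auto
      qed
      ultimately show ?thesis using card_inj_on_le[of f _ "{..<n v}"] by simp
    qed
    show "separates D A B T"
      unfolding separates_def
    proof (intro allI impI notI)
      fix p assume p: "walk D A B p" and disj: "set p \<inter> T = {}"
      \<comment> \<open>Each vertex of a walk avoiding \<open>T\<close> has a copy outside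
        \<open>Z\<close>; lifting through these copies gives a walk that misses
        \<open>Z\<close>.\<close>
      have "\<exists>i < n v. (v, i) \<notin> Z" if "v \<in> set p" for v
        using that disj walk_subset[OF p V(3,2)] unfolding T_def copies_def by auto
      then obtain c where c: "\<And>v. v \<in> set p \<Longrightarrow> c v < n v \<and> (v, c v) \<notin> Z" by metis
      have "successively (\<lambda>u v. ((u, c u), (v, c v)) \<in> E) p"
        using p c unfolding walk_def E_def by (auto elim!: successively_mono)
      then have "walk E (copies A) (copies B) (map (\<lambda>v. (v, c v)) p)"
        using p c unfolding walk_def by (auto simp: hd_map last_map successively_map copies_def)
      then have "set (map (\<lambda>v. (v, c v)) p) \<inter> Z \<noteq> {}" using Z(2) unfolding separates_def by blast
      then show False using c by auto
    qed
    have "sum n T = card (copies T)"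
      using V(1) unfolding copies_def T_def by (subst card_SigmaI) auto
    also have "\<dots> \<le> card Z"
      by (rule card_mono) (use Z(1) in \<open>auto simp: copies_def T_def\<close>)
    finally show "sum n T \<le> card L" using Z(3) by simp
  qed
qed

section \<open>Maximal cliques of a comparability graph\<close>

definition strict_less :: "'a set \<Rightarrow> 'a rel \<Rightarrow> 'a \<Rightarrow> 'a \<Rightarrow> bool" where
  "strict_less X r u v \<longleftrightarrow> u \<in> X \<and> v \<in> X \<and> (u, v) \<in> r \<and> u \<noteq> v"

definition cover_arcs :: "'a set \<Rightarrow> 'a rel \<Rightarrow> 'a rel" where
  "cover_arcs X r =
     {(u, v). strict_less X r u v \<and> (\<nexists>z. strict_less X r u z \<and> strict_less X r z v)}"

definition minimal_elements :: "'a set \<Rightarrow> 'a rel \<Rightarrow> 'a set" where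
  "minimal_elements X r = {v \<in> X. \<nexists>u. strict_less X r u v}"

definition maximal_elements :: "'a set \<Rightarrow> 'a rel \<Rightarrow> 'a set" where
  "maximal_elements X r = {v \<in> X. \<nexists>u. strict_less X r v u}"

lemma transp_strict_less: "partial_order_on X r \<Longrightarrow> transp (strict_less X r)"
  by (rule transpI)
    (auto simp: strict_less_def dest: partial_order_onD(2,3) transD antisymD)

lemma clique_comparability_graph:
  "clique (comparability_graph X r) K \<longleftrightarrow>
     K \<subseteq> X \<and> (\<forall>u\<in>K. \<forall>v\<in>K. u \<noteq> v \<longrightarrow> strict_less X r u v \<or> strict_less X r v u)"
  unfolding clique_def comparability_graph_def strict_less_def
  by (auto simp: doubleton_eq_iff subset_iff) blast+

text \<open>Insertion sort: \<open>a\<close> goes after the elements below it, and by comparability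
  the remaining ones lie above it.\<close>

lemma finite_chain_sorted:
  assumes "finite K" "transp R" "\<forall>u\<in>K. \<forall>v\<in>K. u \<noteq> v \<longrightarrow> R u v \<or> R v u"
  shows "\<exists>p. set p = K \<and> sorted_wrt R p"
  using assms(1,3)
proof (induction K rule: finite_induct)
  case (insert a K)
  then obtain p where p: "set p = K" "sorted_wrt R p" by auto
  let ?p = "filter (\<lambda>z. R z a) p @ a # filter (\<lambda>z. \<not> R z a) p"
  have "set ?p = insert a K" using p(1) by auto
  moreover have "sorted_wrt R ?p"
  proof -
    have "R a z" if "z \<in> K" "\<not> R z a" for z using that insert.prems insert.hyps(2) by (metis insertCI)
    then show ?thesis
      using p \<open>transp R\<close> by (auto simp: sorted_wrt_append sorted_wrt_filter dest: transpD)
  qed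
  ultimately show ?case by blast
qed auto

text \<open>An element off the walk but comparable to all of it lies above the minimal first vertex.
  It stays above along every covering arc, hence exceeds the maximal last vertex, a
  contradiction.\<close>

lemma maximal_clique_if_walk:
  assumes po: "partial_order_on X r"
    and p: "walk (cover_arcs X r) (minimal_elements X r) (maximal_elements X r) p"
  shows "maximal_clique (comparability_graph X r) (set p)"
proof -
  let ?R = "strict_less X r"
  have sub: "set p \<subseteq> X"
    using walk_subset[OF p, of X]
    by (auto simp: cover_arcs_def minimal_elements_def strict_less_def)
  have succ: "successively (\<lambda>u v. (u, v) \<in> cover_arcs X r) p" using p unfolding walk_def by auto
  then have "successively ?R p" by (auto simp: cover_arcs_def elim: successively_mono)
  then have sorted: "sorted_wrt ?R p"
    using transp_strict_less[OF po] by (simp add: successively_conv_sorted_wrt)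
  have chain: "\<forall>u\<in>set q. \<forall>v\<in>set q. u \<noteq> v \<longrightarrow> ?R u v \<or> ?R v u" if "sorted_wrt ?R q" for q
    using that by (induction q) auto
  show ?thesis
    unfolding maximal_clique_def
  proof (intro conjI allI impI)
    show "clique (comparability_graph X r) (set p)"
      using sub chain[OF sorted] by (simp add: clique_comparability_graph)
    fix L assume L: "clique (comparability_graph X r) L \<and> set p \<subseteq> L"
    have "z \<in> set p" if "z \<in> L" for z
    proof (rule ccontr)
      assume "z \<notin> set p"
      then have cmp: "\<forall>u\<in>set p. ?R u z \<or> ?R z u"
        using L that clique_comparability_graph[of X r L] by (metis subsetD)
      have above: "q \<noteq> [] \<Longrightarrow> ?R (hd q) z \<Longrightarrow> \<forall>u\<in>set q. ?R u z \<or> ?R z u \<Longrightarrow>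
          successively (\<lambda>u v. (u, v) \<in> cover_arcs X r) q \<Longrightarrow> ?R (last q) z" for q
      proof (induction q rule: induct_list012)
        case (3 u v q)
        then have "(u, v) \<in> cover_arcs X r" "?R u z" "?R v z \<or> ?R z v" by auto
        \<comment> \<open>The alternative would place \<open>z\<close> strictly between
          \<open>u\<close> and \<open>v\<close>.\<close>
        then have "?R v z" unfolding cover_arcs_def by blast
        then show ?case using "3.IH"(2) "3.prems" by simp
      qed auto
      have "hd p \<in> set p" "p \<noteq> []" using p unfolding walk_def by auto
      then have "?R (hd p) z"
        using cmp p unfolding walk_def minimal_elements_def by blast
      then have "?R (last p) z" using above \<open>p \<noteq> []\<close> cmp succ by blast
      then show False using p unfolding walk_def maximal_elements_def by blast
    qed
    then show "L = set p" using L by blast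
  qed
qed

text \<open>Sort the chain \<open>K\<close>. An element below its first, above its last or between
  two consecutive members could be added to \<open>K\<close>, so the ends are extremal and
  consecutive members form covering pairs.\<close>

lemma walk_if_maximal_clique:
  assumes po: "partial_order_on X r" and "finite X" "X \<noteq> {}"
    and K: "maximal_clique (comparability_graph X r) K"
  obtains p where "walk (cover_arcs X r) (minimal_elements X r) (maximal_elements X r) p"
    "set p = K"
proof -
  let ?R = "strict_less X r"
  have R: "transp ?R" "\<And>u. \<not> ?R u u"
    using transp_strict_less[OF po] by (auto simp: strict_less_def)
  have KX: "K \<subseteq> X" and chain: "\<forall>u\<in>K. \<forall>v\<in>K. u \<noteq> v \<longrightarrow> ?R u v \<or> ?R v u"
    using K unfolding maximal_clique_def clique_comparability_graph by auto
  have max: "z \<in> K" if "z \<in> X" "\<forall>u\<in>K. ?R u z \<or> ?R z u" for z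
  proof -
    have "clique (comparability_graph X r) (insert z K)"
      using KX chain that unfolding clique_comparability_graph by auto
    then show ?thesis using K unfolding maximal_clique_def by blast
  qed
  \<comment> \<open>Any element of \<open>X\<close> is vacuously comparable to all of an empty
    \<open>K\<close>, so maximality would put it into \<open>K\<close>.\<close>
  have "K \<noteq> {}" using max \<open>X \<noteq> {}\<close> by auto
  obtain p where p: "set p = K" "sorted_wrt ?R p"
    using finite_chain_sorted[OF _ R(1) chain] KX \<open>finite X\<close> by (metis finite_subset)
  have ne: "p \<noteq> []" using p(1) \<open>K \<noteq> {}\<close> by auto
  \<comment> \<open>No element fits into a cut of \<open>p\<close>. Empty \<open>q1\<close> or
    \<open>q2\<close> handles the two ends, a cut after position \<open>i\<close> the covering
    pairs.\<close>
  have no_new: False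
    if "p = q1 @ q2" "\<forall>u\<in>set q1. ?R u z" "\<forall>u\<in>set q2. ?R z u" "z \<in> X" for q1 q2 z
  proof -
    have "z \<in> set q1 \<union> set q2" using max[of z] that p(1) by auto
    then show False using that R(2) by blast
  qed
  have "hd p \<in> minimal_elements X r"
  proof -
    have False if z: "?R z (hd p)" for z
    proof (rule no_new[of "[]" p z])
      show "\<forall>u\<in>set p. ?R z u"
        using p(2) ne z transpD[OF R(1) z] by (cases p) auto
    qed (use z in \<open>auto simp: strict_less_def\<close>)
    then show ?thesis using p(1) ne KX unfolding minimal_elements_def by auto
  qed
  moreover have "last p \<in> maximal_elements X r"
  proof -
    have False if z: "?R (last p) z" for z
    proof (rule no_new[of p "[]" z])
      show "\<forall>u\<in>set p. ?R u z"
        using p(2) ne z transpD[OF R(1) _ z]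
        by (cases p rule: rev_cases) (auto simp: sorted_wrt_append)
    qed (use z in \<open>auto simp: strict_less_def\<close>)
    then show ?thesis using p(1) ne KX unfolding maximal_elements_def by auto
  qed
  moreover have "successively (\<lambda>u v. (u, v) \<in> cover_arcs X r) p"
    unfolding successively_conv_nth
  proof (intro allI impI)
    fix i assume i: "Suc i < length p"
    have split: "p = take (Suc i) p @ drop (Suc i) p" by simp
    have lt: "?R (p ! i) (p ! Suc i)" using p(2) i by (simp add: sorted_wrt_iff_nth_less)
    moreover have False if z: "?R (p ! i) z" "?R z (p ! Suc i)" for z
    proof (rule no_new[OF split])
      show "\<forall>u\<in>set (take (Suc i) p). ?R u z"
      proof
        fix u assume "u \<in> set (take (Suc i) p)"
        then obtain j where "j \<le> i" "u = p ! j" using i by (auto simp: in_set_conv_nth less_Suc_eq_le)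
        then show "?R u z"
          using p(2) i z(1) transpD[OF R(1) _ z(1)] by (cases "j = i") (auto simp: sorted_wrt_iff_nth_less)
      qed
      show "\<forall>u\<in>set (drop (Suc i) p). ?R z u"
      proof
        fix u assume "u \<in> set (drop (Suc i) p)"
        then obtain j where "j < length p - Suc i" "u = p ! (Suc i + j)"
          using i by (auto simp: in_set_conv_nth)
        then show "?R z u"
          using p(2) i z(2) transpD[OF R(1) z(2)] by (cases "j = 0") (auto simp: sorted_wrt_iff_nth_less)
      qed
    qed (use z in \<open>auto simp: strict_less_def\<close>)
    ultimately show "(p ! i, p ! Suc i) \<in> cover_arcs X r" unfolding cover_arcs_def by blast
  qed
  ultimately show thesis using that p(1) ne unfolding walk_def by blast
qed

section \<open>The max-flow min-cut property\<close>

text \<open>Weight each \<open>y e\<close> by its covering sum, which is at least 1, exchange the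
  summations, and bound the packing sum at \<open>v\<close> by \<open>w v\<close>.\<close>

lemma weak_duality:
  assumes "finite (vertices C)" "primal_feasible C x" "dual_feasible C w y"
  shows "(\<Sum>e\<in>edges C. y e) \<le> (\<Sum>v\<in>vertices C. w v * x v)"
proof -
  have "(\<Sum>e\<in>edges C. y e) \<le> (\<Sum>e\<in>edges C. y e * (\<Sum>v\<in>vertices C. x v * incidence_matrix v e))"
  proof (rule sum_mono)
    fix e assume "e \<in> edges C"
    then show "y e \<le> y e * (\<Sum>v\<in>vertices C. x v * incidence_matrix v e)"
      using assms(2,3) mult_left_mono[of 1 _ "y e"]
      unfolding primal_feasible_def dual_feasible_def by auto
  qed
  also have "\<dots> = (\<Sum>v\<in>vertices C. (\<Sum>e\<in>edges C. incidence_matrix v e * y e) * x v)"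
    unfolding sum_distrib_left sum_distrib_right
    by (subst sum.swap) (simp add: mult_ac)
  also have "\<dots> \<le> (\<Sum>v\<in>vertices C. w v * x v)"
    using assms(2,3) unfolding primal_feasible_def dual_feasible_def
    by (intro sum_mono mult_right_mono) auto
  finally show ?thesis .
qed

text \<open>By weak duality, feasible vectors without a gap are both optimal among all real feasible
  vectors.\<close>

lemma max_flow_min_cutI:
  assumes fin: "finite (vertices C)"
    and ex: "\<And>w. \<forall>v\<in>vertices C. 0 \<le> w v \<and> w v \<in> \<int> \<Longrightarrow>
      \<exists>x y. (\<forall>v\<in>vertices C. x v \<in> \<int>) \<and> (\<forall>e\<in>edges C. y e \<in> \<int>) \<and>
        primal_feasible C x \<and> dual_feasible C w y \<and>
        (\<Sum>v\<in>vertices C. w v * x v) \<le> (\<Sum>e\<in>edges C. y e)"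
  shows "max_flow_min_cut C"
  unfolding max_flow_min_cut_def
proof (intro allI impI)
  fix w :: "'a \<Rightarrow> real" assume "\<forall>v\<in>vertices C. 0 \<le> w v \<and> w v \<in> \<int>"
  then obtain x y where xy: "\<forall>v\<in>vertices C. x v \<in> \<int>" "\<forall>e\<in>edges C. y e \<in> \<int>"
    "primal_feasible C x" "dual_feasible C w y"
    and le: "(\<Sum>v\<in>vertices C. w v * x v) \<le> (\<Sum>e\<in>edges C. y e)"
    using ex by blast
  have "is_arg_min (\<lambda>x. \<Sum>v\<in>vertices C. w v * x v) (primal_feasible C) x"
    unfolding is_arg_min_def using xy le weak_duality[OF fin _ xy(4)] by force
  moreover have "is_arg_max (\<lambda>y. \<Sum>e\<in>edges C. y e) (dual_feasible C w) y"
    unfolding is_arg_max_def using xy le weak_duality[OF fin xy(3)] by force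
  moreover have "(\<Sum>v\<in>vertices C. w v * x v) = (\<Sum>e\<in>edges C. y e)"
    using le weak_duality[OF fin xy(3,4)] by simp
  ultimately show "\<exists>x y. (\<forall>v\<in>vertices C. x v \<in> \<int>) \<and> (\<forall>e\<in>edges C. y e \<in> \<int>) \<and>
      is_arg_min (\<lambda>x. \<Sum>v\<in>vertices C. w v * x v) (primal_feasible C) x \<and>
      is_arg_max (\<lambda>y. \<Sum>e\<in>edges C. y e) (dual_feasible C w) y \<and>
      (\<Sum>v\<in>vertices C. w v * x v) = (\<Sum>e\<in>edges C. y e)"
    using xy(1,2) by blast
qed

theorem theorem4p1p7:
  fixes X :: "'a set" and r :: "'a rel" and G C :: "'a hypergraph"
  assumes "finite X" and "X \<noteq> {}"
    and "partial_order_on X r"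
    and "G = comparability_graph X r"
    and "C = clique_clutter G"
  shows "max_flow_min_cut C"
proof (rule max_flow_min_cutI)
  have V: "vertices C = X" and E: "edges C = {K. maximal_clique (comparability_graph X r) K}"
    using assms(4,5) by (auto simp: clique_clutter_def comparability_graph_def)
  then show "finite (vertices C)" using assms(1) by simp
  have E_sub: "edges C \<subseteq> Pow X"
    unfolding E by (auto simp: maximal_clique_def clique_comparability_graph)
  then have fin_E: "finite (edges C)" using assms(1) by (auto intro: finite_subset)
  fix w :: "'a \<Rightarrow> real" assume w: "\<forall>v\<in>vertices C. 0 \<le> w v \<and> w v \<in> \<int>"
  \<comment> \<open>The number of copies must be natural; on \<open>X\<close> nothing is lost, since
    \<open>w\<close> is integral and nonnegative there.\<close>
  define n where "n v = nat \<lfloor>w v\<rfloor>" for v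
  have n: "real (n v) = w v" if "v \<in> X" for v
    using w that V unfolding n_def by (auto elim!: Ints_cases)
  let ?W = "walk (cover_arcs X r) (minimal_elements X r) (maximal_elements X r)"
  obtain L :: "('a \<times> nat) list set" and T where
    L: "finite L" "\<And>p. p \<in> L \<Longrightarrow> ?W (map fst p)"
      "\<And>v. card {p \<in> L. v \<in> fst ` set p} \<le> n v"
    and T: "T \<subseteq> X" "separates (cover_arcs X r) (minimal_elements X r) (maximal_elements X r) T"
      "sum n T \<le> card L"
    using menger_weighted[of X "cover_arcs X r" "minimal_elements X r" "maximal_elements X r" n]
      assms(1)
    by (auto simp: cover_arcs_def strict_less_def minimal_elements_def maximal_elements_def)
  define x :: "'a \<Rightarrow> real" where "x = indicator T"
  \<comment> \<open>Several paths of \<open>L\<close> may become equal once copies are forgotten, so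
    \<open>y\<close> records multiplicities.\<close>
  define y :: "'a set \<Rightarrow> real" where "y K = real (card {p \<in> L. fst ` set p = K})" for K
  have path_edge: "fst ` set p \<in> edges C" if "p \<in> L" for p
    using maximal_clique_if_walk[OF assms(3) L(2)[OF that]] unfolding E by simp
  \<comment> \<open>Each path of \<open>L\<close> is counted at exactly one edge. \<open>P\<close>
    is later containment of a vertex \<open>v\<close>, for feasibility, and \<open>True\<close>, for
    the total.\<close>
  have sum_y: "(\<Sum>K\<in>{K \<in> edges C. P K}. y K) = real (card {p \<in> L. P (fst ` set p)})" for P
  proof -
    have "card {p \<in> L. P (fst ` set p)} =
        (\<Sum>K\<in>{K \<in> edges C. P K}. card {p \<in> {p \<in> L. P (fst ` set p)}. fst ` set p = K})"
      using sum.group[of "{p \<in> L. P (fst ` set p)}" "{K \<in> edges C. P K}" "\<lambda>p. fst ` set p" "\<lambda>_. 1 :: nat"]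
        L(1) fin_E path_edge by fastforce
    also have "\<dots> = (\<Sum>K\<in>{K \<in> edges C. P K}. card {p \<in> L. fst ` set p = K})"
      by (intro sum.cong arg_cong[of _ _ card]) auto
    finally show ?thesis unfolding y_def by simp
  qed
  have "primal_feasible C x"
    unfolding primal_feasible_def
  proof (intro conjI ballI)
    fix K assume K: "K \<in> edges C"
    then obtain p where "?W p" "set p = K"
      using walk_if_maximal_clique[OF assms(3,1,2)] unfolding E by blast
    then obtain v where v: "v \<in> K" "v \<in> T" using T(2) unfolding separates_def by blast
    \<comment> \<open>\<open>T\<close> meets the walk that traverses \<open>K\<close>, and the term
      of one common vertex already gives the bound 1.\<close>
    then have "1 = x v * incidence_matrix v K" by (simp add: x_def incidence_matrix_def)
    also have "\<dots> \<le> (\<Sum>v\<in>vertices C. x v * incidence_matrix v K)"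
      by (rule member_le_sum) (use v T(1) V assms(1) in \<open>auto simp: x_def incidence_matrix_def\<close>)
    finally show "1 \<le> (\<Sum>v\<in>vertices C. x v * incidence_matrix v K)" .
  qed (simp add: x_def)
  moreover have "dual_feasible C w y"
    unfolding dual_feasible_def
  proof (intro conjI ballI)
    fix v assume v: "v \<in> vertices C"
    \<comment> \<open>This sum counts the paths of \<open>L\<close> through a copy of
      \<open>v\<close>.\<close>
    have "(\<Sum>K\<in>edges C. incidence_matrix v K * y K) = (\<Sum>K\<in>{K \<in> edges C. v \<in> K}. y K)"
      using fin_E by (intro sum.mono_neutral_cong_right) (auto simp: incidence_matrix_def)
    also have "\<dots> \<le> real (n v)" using L(3)[of v] by (simp add: sum_y)
    finally show "(\<Sum>K\<in>edges C. incidence_matrix v K * y K) \<le> w v" using n v V by simp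
  qed (simp add: y_def)
  moreover have "(\<Sum>v\<in>vertices C. w v * x v) \<le> (\<Sum>K\<in>edges C. y K)"
  proof -
    have "(\<Sum>v\<in>vertices C. w v * x v) = (\<Sum>v\<in>T. real (n v))"
      using V T(1) assms(1) n by (intro sum.mono_neutral_cong_right) (auto simp: x_def)
    also have "\<dots> \<le> real (card L)" using T(3) by (metis of_nat_mono of_nat_sum)
    also have "\<dots> = (\<Sum>K\<in>edges C. y K)" using sum_y[of "\<lambda>_. True"] by simp
    finally show ?thesis .
  qed
  moreover have "\<forall>v\<in>vertices C. x v \<in> \<int>" "\<forall>K\<in>edges C. y K \<in> \<int>"
    by (auto simp: x_def y_def indicator_def)
  ultimately show "\<exists>x y. (\<forall>v\<in>vertices C. x v \<in> \<int>) \<and> (\<forall>e\<in>edges C. y e \<in> \<int>) \<and>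
      primal_feasible C x \<and> dual_feasible C w y \<and>
      (\<Sum>v\<in>vertices C. w v * x v) \<le> (\<Sum>e\<in>edges C. y e)"
    by blast
qed

end
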